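(* For every set $S$, the topological space $\mathrm{TO}(S)$ is compact.
   Context: For a set $S$, $\mathrm{TO}(S)$ is the set of all total orderings on $S$, i.e. binary relations ${\preceq}$ on $S$ that are antisymmetric, transitive and total ($a\preceq b$ or $b\preceq a$ for all $a,b\in S$). It is endowed with the topology $\mathcal{U}(S)$ having as subbasis the sets $\mathfrak{U}_{(a,b)}=\{{\preceq}\in\mathrm{TO}(S)\mid a\preceq b\}$, $(a,b)\in S\times S$. Compact means that every open covering has a finite subcovering. *)

theory Defs
  imports "HOL-Analysis.Analysis"
begin

(* Totality is written out because total_on only constrains distinct elements;
   the case a = b of the condition below gives reflexivity on S. *)
definition TO :: "'a set \<Rightarrow> 'a rel set" where
  "TO S = {r. r \<subseteq> S \<times> S \<and> antisym r \<and> trans r \<and>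
              (\<forall>a\<in>S. \<forall>b\<in>S. (a, b) \<in> r \<or> (b, a) \<in> r)}"

lemma TO_eq_linear_orders:
  fixes S :: "'a set"
  shows "TO S = {r. linear_order_on S r}"
proof -
  have "(a, b) \<in> r \<or> (b, a) \<in> r"
    if "refl_on S r" "total_on S r" "a \<in> S" "b \<in> S" for r :: "'a rel" and a b
    using that by (cases "a = b") (auto simp: refl_on_def total_on_def)
  moreover have "refl_on S r \<and> total_on S r"
    if "\<forall>a\<in>S. \<forall>b\<in>S. (a, b) \<in> r \<or> (b, a) \<in> r" for r :: "'a rel"
    using that by (auto simp: refl_on_def total_on_def)
  ultimately show ?thesis
    unfolding TO_def order_on_defs by (intro Collect_cong) blast
qed

definition TO_subbasic :: "'a set \<Rightarrow> 'a \<times> 'a \<Rightarrow> 'a rel set" where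
  "TO_subbasic S p = {r \<in> TO S. p \<in> r}"

(* Unlike topology_generated_by, this form counts TO S itself as the empty intersection of
   subbasic sets. This matters only for S = {}, where there are no subbasic sets
   although TO {} has one element. *)
definition TO_topology :: "'a set \<Rightarrow> 'a rel topology" where
  "TO_topology S =
     topology (arbitrary union_of
       (finite intersection_of (\<lambda>U. U \<in> TO_subbasic S ` (S \<times> S)) relative_to TO S))"

lemma topspace_TO_topology [simp]: "topspace (TO_topology S) = TO S"
  by (simp add: TO_topology_def)

end

theory Submission
  imports Defs
begin

(* Identify a relation on S with its characteristic function in the product, over S \<times> S, of
   copies of the two-point discrete space, which is compact by Tychonoff's theorem.
   Each instance of antisymmetry, transitivity or totality involves finitely many coordinates,
   so the total orderings form a closed, hence compact, subset. The topology of TO S is coarser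
   than the one inherited from the product, hence compact as well. *)

lemma continuous_map_coordinate_discrete:
  assumes "p \<in> I"
  shows "continuous_map (product_topology (\<lambda>_. discrete_topology UNIV) I)
           (discrete_topology UNIV) (\<lambda>f. f p)"
  using continuous_map_product_projection[OF assms, of "\<lambda>_. discrete_topology UNIV"] by simp

lemma openin_coordinate:
  fixes I :: "'i set"
  defines "X \<equiv> product_topology (\<lambda>_. discrete_topology (UNIV :: bool set)) I"
  assumes "p \<in> I"
  shows "openin X {f \<in> topspace X. f p}"
  using openin_continuous_map_preimage[OF continuous_map_coordinate_discrete[OF assms(2)], of "{True}"]
  by (simp add: X_def)

text \<open>Every subset of a discrete factor is closed, so both values of a coordinate give closed
  sets. The negated form is needed because antisymmetry and transitivity have membership as a
  premise.\<close>

lemma closedin_coordinate: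
  fixes I :: "'i set"
  defines "X \<equiv> product_topology (\<lambda>_. discrete_topology (UNIV :: bool set)) I"
  assumes "p \<in> I"
  shows "closedin X {f \<in> topspace X. f p}" "closedin X {f \<in> topspace X. \<not> f p}"
  using closedin_continuous_map_preimage[OF continuous_map_coordinate_discrete[OF assms(2)], of "{True}"]
    closedin_continuous_map_preimage[OF continuous_map_coordinate_discrete[OF assms(2)], of "{False}"]
  by (simp_all add: X_def)

lemma closedin_Collect_disj:
  assumes "closedin X {x \<in> topspace X. P x}" "closedin X {x \<in> topspace X. Q x}"
  shows "closedin X {x \<in> topspace X. P x \<or> Q x}"
  using closedin_Un[OF assms] by (simp add: Collect_disj_eq[symmetric] conj_disj_distribL)

lemma closedin_Collect_conj:
  assumes "closedin X {x \<in> topspace X. P x}" "closedin X {x \<in> topspace X. Q x}"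
  shows "closedin X {x \<in> topspace X. P x \<and> Q x}"
  using closedin_Int[OF assms] by (rule back_subst) auto

lemma closedin_Collect_ball:
  assumes "\<And>a. a \<in> A \<Longrightarrow> closedin X {x \<in> topspace X. P a x}"
  shows "closedin X {x \<in> topspace X. \<forall>a\<in>A. P a x}"
proof -
  \<comment> \<open>Inserting \<open>topspace X\<close> keeps the family nonempty when
    \<open>A\<close> is empty, where the bare intersection would be \<open>UNIV\<close>.\<close>
  have "closedin X (\<Inter>(insert (topspace X) ((\<lambda>a. {x \<in> topspace X. P a x}) ` A)))"
    using assms by (intro closedin_Inter) auto
  then show ?thesis by (rule back_subst) auto
qed

theorem theorem1p5:
  fixes S :: "'a set"
  shows "compact_space (TO_topology S)"
proof -
  define X where "X = product_topology (\<lambda>_. discrete_topology (UNIV :: bool set)) (S \<times> S)"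
  define rel where "rel f = {p \<in> S \<times> S. f p}" for f :: "'a \<times> 'a \<Rightarrow> bool"
  define K where "K = {f \<in> topspace X. rel f \<in> TO S}"
  have top: "topspace X = (S \<times> S) \<rightarrow>\<^sub>E UNIV"
    by (simp add: X_def)
  have "compact_space X"
    by (simp add: X_def compact_space_product_topology compact_space_discrete_topology)
  moreover have "closedin X K"
  proof -
    \<comment> \<open>Implications are written as disjunctions of possibly negated coordinates, so
      that each instance is a finite union of closed sets.\<close>
    have coords: "rel f \<in> TO S \<longleftrightarrow>
        (\<forall>a\<in>S. \<forall>b\<in>S. a = b \<or> \<not> f (a, b) \<or> \<not> f (b, a)) \<and>
        (\<forall>a\<in>S. \<forall>b\<in>S. \<forall>c\<in>S. \<not> f (a, b) \<or> \<not> f (b, c) \<or> f (a, c)) \<and>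
        (\<forall>a\<in>S. \<forall>b\<in>S. f (a, b) \<or> f (b, a))" for f
      unfolding TO_def rel_def antisym_def trans_def by blast
    \<comment> \<open>The condition does not involve \<open>f\<close>: the set is the whole space or
      empty.\<close>
    have const: "closedin X {f \<in> topspace X. a = b}" for a b :: 'a
      by (cases "a = b") auto
    show ?thesis
      unfolding K_def coords
      by (intro closedin_Collect_conj closedin_Collect_ball closedin_Collect_disj const
          closedin_coordinate[where I = "S \<times> S", folded X_def]) auto
  qed
  ultimately have "compactin X K"
    by (rule closedin_compact_space)
  then have "compact_space (subtopology X K)"
    by (simp add: compactin_subspace)
  moreover have "continuous_map (subtopology X K) (TO_topology S) rel"
    unfolding TO_topology_def
  proof (rule continuous_map_into_topology_subbase)
    show "rel f \<in> topspace (topology (arbitrary union_of (finite intersection_of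
        (\<lambda>U. U \<in> TO_subbasic S ` (S \<times> S)) relative_to TO S)))"
      if "f \<in> topspace (subtopology X K)" for f
      using that by (simp add: K_def)
  next
    fix U assume "U \<in> TO_subbasic S ` (S \<times> S)"
    then obtain p where p: "p \<in> S \<times> S" and U: "U = TO_subbasic S p"
      by blast
    \<comment> \<open>For continuity it suffices to pull back subbasic sets; each preimage is the
      trace on \<open>K\<close> of an open cylinder.\<close>
    have "{f \<in> topspace (subtopology X K). rel f \<in> U} = K \<inter> {f \<in> topspace X. f p}"
      using p by (auto simp: U TO_subbasic_def K_def rel_def)
    then show "openin (subtopology X K) {f \<in> topspace (subtopology X K). rel f \<in> U}"
      using openin_coordinate(1)[OF p] by (simp add: X_def openin_subtopology_Int2)
  qed
  moreover have "rel ` topspace (subtopology X K) = TO S"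
  proof
    show "rel ` topspace (subtopology X K) \<subseteq> TO S"
      by (auto simp: K_def)
    show "TO S \<subseteq> rel ` topspace (subtopology X K)"
    proof
      fix r assume r: "r \<in> TO S"
      \<comment> \<open>Points of the product are extensional, so the characteristic function of
        \<open>r\<close> must be cut down to \<open>S \<times> S\<close>.\<close>
      let ?f = "restrict (\<lambda>p. p \<in> r) (S \<times> S)"
      have "rel ?f = r"
        using r by (auto simp: rel_def TO_def)
      then show "r \<in> rel ` topspace (subtopology X K)"
        using r by (intro image_eqI[of _ _ ?f]) (auto simp: K_def top)
    qed
  qed
  \<comment> \<open>\<open>TO S\<close> is the image of a compact space under the continuous map
    \<open>rel\<close>.\<close>
  ultimately show ?thesis
    using image_compactin[of "subtopology X K" "topspace (subtopology X K)" "TO_topology S" rel]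
    by (simp add: compact_space_def)
qed

end
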